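(* Let $\ell\ge 3$ and let $I$ be an ideal of $\Phi^+(B_\ell)$ with $\epsilon_1\in I$. Set $J:=I\smallsetminus\{\epsilon_i \mid \epsilon_i\in I\}$, regarded as a subset of $\Phi^+(D_\ell)$. For $1\le k\le \ell$ let $d_k^{(+)}:=\#\{j \mid k<j\le \ell,\ \epsilon_k+\epsilon_j\in I\}$ and $d_k^{(-)}:=\#\{j\mid k<j\le\ell,\ \epsilon_k-\epsilon_j\in I\}$, put $d_0^{(+)}:=0$, and let $p_k:=d_k^{(-)}+d_{k-1}^{(+)}$ for $1\le k\le\ell$. Then for every even positive integer $q$, $$\chi^{\mathrm{quasi}}_{T_I}(B_\ell,q)=\chi^{\mathrm{quasi}}_{T_J}(D_\ell,q-1)=\prod_{i=1}^{\ell}(q-p_i-1).$$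
   Context: Let $\epsilon_1,\dots,\epsilon_\ell$ be an orthonormal basis of an $\ell$-dimensional Euclidean space. Type $B_\ell$: positive roots $\Phi^+(B_\ell)=\{\epsilon_i\ (1\le i\le\ell),\ \epsilon_i\pm\epsilon_j\ (1\le i<j\le\ell)\}$, simple roots $\alpha_i=\epsilon_i-\epsilon_{i+1}$ ($1\le i\le\ell-1$), $\alpha_\ell=\epsilon_\ell$. Type $D_\ell$ ($\ell\ge 3$): positive roots $\Phi^+(D_\ell)=\{\epsilon_i\pm\epsilon_j\ (1\le i<j\le\ell)\}$. On the set of positive roots, $\beta_1\succeq\beta_2$ means that $\beta_1-\beta_2$ is a linear combination of simple roots with nonnegative integer coefficients. A subset $I\subseteq\Phi^+$ is an ideal if $\beta_1\in I$, $\beta_2\in\Phi^+$ and $\beta_1\succeq\beta_2$ imply $\beta_2\in I$. For a set $\Psi$ of positive roots, $T_\Psi$ is the $\ell\times\#\Psi$ integer matrix whose columns are the coordinate vectors of the elements of $\Psi$ with respect to $\epsilon_1,\dots,\epsilon_\ell$. For a root system $\Phi$ of type $B_\ell$ or $D_\ell$ and a positive integer $q$, $$\chi^{\mathrm{quasi}}_{T_\Psi}(\Phi,q):=\#\{\mathbf z\in(\mathbb Z/q\mathbb Z)^\ell \mid \text{every entry of } \mathbf z\cdot T_\Psi \text{ is nonzero in } \mathbb Z/q\mathbb Z\}$$ (the characteristic quasi-polynomial of $\Psi$ with respect to the integer lattice; the symbol $\Phi$ only records the ambient type). *)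

theory Defs
  imports Main "HOL-Library.Function_Algebras" "HOL-Library.FuncSet"
begin

text \<open>Vectors are represented by their integer coordinate functions with respect to
  \<open>\<epsilon>\<^sub>1, \<dots>, \<epsilon>\<^sub>l\<close>; the coordinates are indexed by \<open>1, \<dots>, l\<close>, and all other values of a
  root are 0.\<close>

definition eps :: "nat \<Rightarrow> nat \<Rightarrow> int" where
  "eps i = (\<lambda>k. if k = i then 1 else 0)"

definition pos_roots_B :: "nat \<Rightarrow> (nat \<Rightarrow> int) set" where
  "pos_roots_B l =
     {eps i | i. 1 \<le> i \<and> i \<le> l} \<union>
     {eps i + eps j | i j. 1 \<le> i \<and> i < j \<and> j \<le> l} \<union>
     {eps i - eps j | i j. 1 \<le> i \<and> i < j \<and> j \<le> l}"

definition pos_roots_D :: "nat \<Rightarrow> (nat \<Rightarrow> int) set" where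
  "pos_roots_D l =
     {eps i + eps j | i j. 1 \<le> i \<and> i < j \<and> j \<le> l} \<union>
     {eps i - eps j | i j. 1 \<le> i \<and> i < j \<and> j \<le> l}"

definition simple_root_B :: "nat \<Rightarrow> nat \<Rightarrow> nat \<Rightarrow> int" where
  "simple_root_B l i = (if i < l then eps i - eps (Suc i) else eps l)"

definition root_ge_B :: "nat \<Rightarrow> (nat \<Rightarrow> int) \<Rightarrow> (nat \<Rightarrow> int) \<Rightarrow> bool" where
  "root_ge_B l \<beta>1 \<beta>2 \<longleftrightarrow>
     (\<exists>c :: nat \<Rightarrow> nat. \<beta>1 - \<beta>2 = (\<Sum>i=1..l. (\<lambda>k. int (c i) * simple_root_B l i k)))"

definition ideal_B :: "nat \<Rightarrow> (nat \<Rightarrow> int) set \<Rightarrow> bool" where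
  "ideal_B l I \<longleftrightarrow>
     I \<subseteq> pos_roots_B l \<and>
     (\<forall>\<beta>1\<in>I. \<forall>\<beta>2\<in>pos_roots_B l. root_ge_B l \<beta>1 \<beta>2 \<longrightarrow> \<beta>2 \<in> I)"

text \<open>The columns of \<open>T\<^sub>\<Psi>\<close> are indexed by the elements of \<open>\<Psi>\<close> themselves, so that no
  ordering of \<open>\<Psi>\<close> has to be chosen: the entry in row \<open>i\<close> and column \<open>\<beta>\<close> is \<open>\<beta> i\<close>, and the
  entry of \<open>z \<cdot> T\<^sub>\<Psi>\<close> in column \<open>\<beta>\<close> is \<open>\<Sum>i=1..l. z i * \<beta> i\<close>.  Elements of \<open>\<int>/q\<int>\<close> are
  represented by their residues in \<open>{0..<q}\<close>; for \<open>q = 1\<close> this is the zero ring.  The count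
  depends on the ambient type only through \<open>l\<close>, so that the root system is not an argument.\<close>

definition chi_quasi :: "nat \<Rightarrow> (nat \<Rightarrow> int) set \<Rightarrow> nat \<Rightarrow> nat" where
  "chi_quasi l \<Psi> q =
     card {z \<in> {1..l} \<rightarrow>\<^sub>E {0..<int q}. \<forall>\<beta>\<in>\<Psi>. (\<Sum>i=1..l. z i * \<beta> i) mod int q \<noteq> 0}"

definition d_plus :: "nat \<Rightarrow> (nat \<Rightarrow> int) set \<Rightarrow> nat \<Rightarrow> nat" where
  "d_plus l I k = (if k = 0 then 0 else card {j. k < j \<and> j \<le> l \<and> eps k + eps j \<in> I})"

definition d_minus :: "nat \<Rightarrow> (nat \<Rightarrow> int) set \<Rightarrow> nat \<Rightarrow> nat" where
  "d_minus l I k = card {j. k < j \<and> j \<le> l \<and> eps k - eps j \<in> I}"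

text \<open>Only used for \<open>1 \<le> k\<close>.\<close>

definition p_num :: "nat \<Rightarrow> (nat \<Rightarrow> int) set \<Rightarrow> nat \<Rightarrow> nat" where
  "p_num l I k = d_minus l I k + d_plus l I (k - 1)"

text \<open>The set \<open>J\<close> obtained from an ideal of type \<open>B\<close> by discarding the short roots
  consists of roots of type \<open>D\<close>.\<close>

lemma remove_short_roots_subset:
  assumes "I \<subseteq> pos_roots_B l"
  shows "I - {eps i | i. 1 \<le> i \<and> i \<le> l \<and> eps i \<in> I} \<subseteq> pos_roots_D l"
  using assms unfolding pos_roots_B_def pos_roots_D_def by blast

end

theory Submission
  imports Defs
begin

text \<open>
  An ideal \<open>I\<close> that contains \<open>\<epsilon>\<^sub>1\<close> contains every \<open>\<epsilon>\<^sub>i\<close> and every \<open>\<epsilon>\<^sub>i - \<epsilon>\<^sub>j\<close> with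
  \<open>i < j\<close>, and its roots \<open>\<epsilon>\<^sub>i + \<epsilon>\<^sub>j\<close> form a staircase: they are given by thresholds \<open>s i\<close>
  through \<open>s i \<le> j\<close>, and \<open>s\<close> decreases weakly as long as \<open>s i > i + 1\<close>. The count for \<open>I\<close>
  modulo \<open>q\<close> is therefore the number of tuples with pairwise distinct entries in
  \<open>A = \<int>/q - {0}\<close> such that \<open>z\<^sub>i \<noteq> - z\<^sub>j\<close> whenever \<open>i < j\<close> and \<open>s i \<le> j\<close>. For \<open>J\<close> modulo
  \<open>q - 1\<close> it is the same count with \<open>A = \<int>/(q - 1)\<close>. In both cases \<open>A\<close> has \<open>q - 1\<close> elements
  and negation has exactly one fixed point \<open>e\<close> on it: \<open>e = q/2\<close> in the first case because \<open>q\<close>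
  is even, \<open>e = 0\<close> in the second because \<open>q - 1\<close> is odd. Only these two data matter, so it
  suffices to do one count, for an arbitrary finite set with an involution that has a single
  fixed point; both equalities of the theorem follow.

  The count chooses \<open>z\<^sub>l, \<dots>, z\<^sub>1\<close> in this order. The entry \<open>z\<^sub>m\<close> must avoid the \<open>l - m\<close> later
  entries and the \<open>d\<^sub>m\<close> negatives of the entries at the positions \<open>s m, \<dots>, l\<close>. The staircase
  shape forces these values to be different from each other, with one exception: if \<open>e\<close> occurs
  at one of the positions \<open>s m, \<dots>, l\<close>, then it is counted twice (\<open>card_free\<close>). The number of
  choices thus depends on the position of \<open>e\<close>, and the naive product fails. The remedy is to
  prove, by downward induction on \<open>m\<close>, formulas for two quantities at once (\<open>counts\<close>): the
  number of admissible tuples \<open>(z\<^sub>m, \<dots>, z\<^sub>l)\<close>, and the number of those among them in which \<open>e\<close>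
  occurs at a position \<open>\<ge> c\<close>, for every \<open>c\<close> that the staircase allows as a value of
  \<open>s (m - 1)\<close>. The second number is proportional to the number \<open>l + 1 - c\<close> of these positions,
  and with this the corrections combine to a product again, with the index of \<open>d\<close> shifted by
  one: this is the source of the shift in \<open>p\<^sub>k = d\<^sub>k\<^sup>- + d\<^sub>k\<^sub>-\<^sub>1\<^sup>+\<close>.
\<close>

section \<open>Tuples avoiding a staircase of opposite pairs\<close>

text \<open>
  The threshold \<open>s k = l + 1\<close> encodes that \<open>k\<close> has no constraint of the form
  \<open>z\<^sub>k \<noteq> neg z\<^sub>j\<close>. The maximum in \<open>s_stair\<close> is needed because the constraints of \<open>i\<close> may reach
  down to positions \<open>\<le> k\<close>, where those of \<open>k\<close> cannot follow; then they are all present.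
\<close>

locale staircase_count =
  fixes A :: "'a set" and neg :: "'a \<Rightarrow> 'a" and e :: 'a
    and l :: nat and s :: "nat \<Rightarrow> nat"
  assumes finite_A: "finite A"
    and neg_in: "a \<in> A \<Longrightarrow> neg a \<in> A"
    and neg_neg: "a \<in> A \<Longrightarrow> neg (neg a) = a"
    and e_in: "e \<in> A"
    and neg_eq_iff: "a \<in> A \<Longrightarrow> neg a = a \<longleftrightarrow> a = e"
    and s_gt: "1 \<le> k \<Longrightarrow> k \<le> l \<Longrightarrow> k < s k"
    and s_le: "1 \<le> k \<Longrightarrow> k \<le> l \<Longrightarrow> s k \<le> Suc l"
    and s_stair: "1 \<le> i \<Longrightarrow> i < k \<Longrightarrow> k \<le> l \<Longrightarrow> s k \<le> max (s i) (Suc k)"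
begin

definition admissible :: "nat \<Rightarrow> (nat \<Rightarrow> 'a) set" where
  "admissible m = {z \<in> {m..l} \<rightarrow>\<^sub>E A.
     \<forall>i j. m \<le> i \<and> i < j \<and> j \<le> l \<longrightarrow> z i \<noteq> z j \<and> (s i \<le> j \<longrightarrow> z i \<noteq> neg (z j))}"

definition free :: "nat \<Rightarrow> (nat \<Rightarrow> 'a) \<Rightarrow> 'a set" where
  "free m w = A - (w ` {Suc m..l} \<union> neg ` w ` {s m..l})"

lemma finite_admissible: "finite (admissible m)"
  unfolding admissible_def
  by (rule finite_subset[of _ "{m..l} \<rightarrow>\<^sub>E A"]) (auto intro: finite_PiE finite_A)

lemma admissible_in: "w \<in> admissible m \<Longrightarrow> i \<in> {m..l} \<Longrightarrow> w i \<in> A"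
  unfolding admissible_def by (auto simp: PiE_def Pi_def)

lemma admissible_neq:
  assumes "w \<in> admissible m" "m \<le> i" "i < j" "j \<le> l"
  shows "w i \<noteq> w j" "s i \<le> j \<Longrightarrow> w i \<noteq> neg (w j)"
  using assms unfolding admissible_def by auto

lemma admissible_inj: "w \<in> admissible m \<Longrightarrow> inj_on w {m..l}"
  by (rule linorder_inj_onI') (auto dest: admissible_neq(1))

lemma admissible_Suc_iff:
  assumes m: "1 \<le> m" "m \<le> l"
  shows "z \<in> admissible m \<longleftrightarrow>
    (\<exists>w \<in> admissible (Suc m). \<exists>y \<in> free m w. z = w(m := y))"
proof
  assume z: "z \<in> admissible m"
  let ?w = "z(m := undefined)"
  have "?w \<in> {Suc m..l} \<rightarrow>\<^sub>E A"
    using z unfolding admissible_def by (auto simp: PiE_def Pi_def extensional_def)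
  then have w: "?w \<in> admissible (Suc m)"
    using z unfolding admissible_def by auto
  have "z m \<noteq> neg (z j)" if "j \<in> {s m..l}" for j
    using admissible_neq(2)[OF z, of m j] s_gt[OF m] that by auto
  moreover have "z m \<noteq> z j" if "j \<in> {Suc m..l}" for j
    using admissible_neq(1)[OF z, of m j] that by auto
  moreover have "z m \<in> A" using admissible_in[OF z] m by auto
  moreover have "?w ` {Suc m..l} = z ` {Suc m..l}" "?w ` {s m..l} = z ` {s m..l}"
    by (rule image_cong; use s_gt[OF m] in simp)+
  ultimately have "z m \<in> free m ?w"
    unfolding free_def by (simp add: image_iff)
  then show "\<exists>w \<in> admissible (Suc m). \<exists>y \<in> free m w. z = w(m := y)"
    using w by (intro bexI[of _ ?w] bexI[of _ "z m"]) auto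
next
  assume "\<exists>w \<in> admissible (Suc m). \<exists>y \<in> free m w. z = w(m := y)"
  then obtain w y where w: "w \<in> admissible (Suc m)" and y: "y \<in> free m w"
    and z: "z = w(m := y)" by blast
  have yA: "y \<in> A" using y by (auto simp: free_def)
  have "z \<in> {m..l} \<rightarrow>\<^sub>E A"
    using w yA m unfolding z admissible_def by (auto simp: PiE_def Pi_def extensional_def)
  moreover have "z i \<noteq> z j \<and> (s i \<le> j \<longrightarrow> z i \<noteq> neg (z j))"
    if "m \<le> i" "i < j" "j \<le> l" for i j
  proof (cases "i = m")
    case True
    then show ?thesis using y that unfolding z free_def by auto
  next
    case False
    then show ?thesis using admissible_neq[OF w, of i j] that unfolding z by auto
  qed
  ultimately show "z \<in> admissible m" unfolding admissible_def by auto
qed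

text \<open>An admissible tuple on \<open>{m..l}\<close> is an admissible tuple on \<open>{m+1..l}\<close> together with a
  free value at \<open>m\<close>. Stating this for sums of an arbitrary weight \<open>f\<close> covers both quantities of
  the induction, the plain count and the count of the tuples in which \<open>e\<close> occurs.\<close>

lemma sum_admissible:
  fixes f :: "(nat \<Rightarrow> 'a) \<Rightarrow> int"
  assumes m: "1 \<le> m" "m \<le> l"
  shows "(\<Sum>z\<in>admissible m. f z) =
    (\<Sum>w\<in>admissible (Suc m). \<Sum>y\<in>free m w. f (w(m := y)))"
proof -
  have fin: "finite (free m w)" for w unfolding free_def using finite_A by auto
  have inj: "inj_on (\<lambda>(w, y). w(m := y)) (SIGMA w:admissible (Suc m). free m w)"
  proof (rule inj_onI, clarsimp)
    fix w y w' y'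
    assume w: "w \<in> admissible (Suc m)" "w' \<in> admissible (Suc m)"
      and eq: "w(m := y) = w'(m := y')"
    have "w m = w' m" using w unfolding admissible_def by (auto simp: PiE_def extensional_def)
    then show "w = w' \<and> y = y'" using eq by (metis fun_upd_eqD fun_upd_triv fun_upd_upd)
  qed
  have img: "admissible m =
    (\<lambda>(w, y). w(m := y)) ` (SIGMA w:admissible (Suc m). free m w)"
    unfolding set_eq_iff admissible_Suc_iff[OF m] by (simp add: image_iff)
  have "(\<Sum>z\<in>admissible m. f z) =
    (\<Sum>(w, y)\<in>(SIGMA w:admissible (Suc m). free m w). f (w(m := y)))"
    unfolding img by (subst sum.reindex[OF inj]) (auto intro: sum.cong)
  also have "\<dots> = (\<Sum>w\<in>admissible (Suc m). \<Sum>y\<in>free m w. f (w(m := y)))"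
    by (rule sum.Sigma[symmetric]) (auto simp: finite_admissible fin)
  finally show ?thesis .
qed

text \<open>If a later entry \<open>w i\<close> is opposite to an entry \<open>w j\<close> that constrains position \<open>m\<close>, then
  \<open>i \<noteq> j\<close> is impossible: the staircase carries the constraint of \<open>m\<close> against \<open>j\<close> over to the pair
  \<open>{i, j}\<close>. So \<open>i = j\<close>, and \<open>w i\<close> is its own opposite.\<close>

lemma admissible_coincidence:
  assumes m: "1 \<le> m" "m \<le> l" and w: "w \<in> admissible (Suc m)"
    and i: "i \<in> {Suc m..l}" and j: "j \<in> {s m..l}" and eq: "w i = neg (w j)"
  shows "w i = e"
proof -
  have j': "j \<in> {Suc m..l}" using j s_gt[OF m] by auto
  have wj: "w j \<in> A" using admissible_in[OF w j'] .
  consider "i < j" | "j < i" | "i = j" by linarith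
  then show ?thesis
  proof cases
    case 1
    then have "s i \<le> j" using s_stair[of m i] m i j by auto
    then show ?thesis using admissible_neq(2)[OF w, of i j] 1 i j eq by auto
  next
    case 2
    then have "s j \<le> i" using s_stair[of m j] m i j j' by auto
    moreover have "w j = neg (w i)" using eq neg_neg[OF wj] by simp
    ultimately show ?thesis using admissible_neq(2)[OF w, of j i] 2 i j' by auto
  next
    case 3
    then show ?thesis using eq neg_eq_iff[OF wj] by simp
  qed
qed

text \<open>Inclusion and exclusion for the \<open>l - m\<close> later entries and the \<open>l + 1 - s m\<close> opposites; by
  the previous lemma they can only share \<open>e\<close>.\<close>

lemma card_free:
  assumes m: "1 \<le> m" "m \<le> l" and w: "w \<in> admissible (Suc m)"
  shows "int (card (free m w)) = int (card A) - int (l - m) - int (Suc l - s m)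
    + of_bool (e \<in> w ` {s m..l})"
proof -
  let ?S = "w ` {Suc m..l}" and ?T = "neg ` w ` {s m..l}"
  have sub: "{s m..l} \<subseteq> {Suc m..l}" using s_gt[OF m] by auto
  have inA: "w ` {Suc m..l} \<subseteq> A" using admissible_in[OF w] by auto
  have "inj_on neg A" by (metis inj_on_inverseI neg_neg)
  then have "card ?T = card (w ` {s m..l})"
    using inA sub by (intro card_image) (meson image_mono inj_on_subset order_trans)
  also have "\<dots> = Suc l - s m"
    using inj_on_subset[OF admissible_inj[OF w] sub] by (simp add: card_image)
  finally have cT: "card ?T = Suc l - s m" .
  have cS: "card ?S = l - m"
    using admissible_inj[OF w] by (simp add: card_image)
  have "?S \<inter> ?T = (if e \<in> w ` {s m..l} then {e} else {})"
  proof -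
    have "x = e \<and> e \<in> w ` {s m..l}" if x: "x \<in> ?S" "x \<in> ?T" for x
    proof -
      obtain i j where ij: "i \<in> {Suc m..l}" "j \<in> {s m..l}" "x = w i" "x = neg (w j)"
        using x by auto
      then have "x = e" using admissible_coincidence[OF m w ij(1,2)] by simp
      moreover have "w j \<in> A" using inA sub ij by auto
      ultimately have "w j = e" using ij neg_eq_iff e_in neg_neg by metis
      then show ?thesis using \<open>x = e\<close> ij by auto
    qed
    moreover have "e \<in> ?S \<inter> ?T" if "e \<in> w ` {s m..l}"
    proof -
      have "neg e = e" using neg_eq_iff[OF e_in] by simp
      then have "e \<in> ?T" using that by (metis imageI)
      then show ?thesis using that sub by auto
    qed
    ultimately show ?thesis by auto
  qed
  then have cI: "int (card (?S \<inter> ?T)) = of_bool (e \<in> w ` {s m..l})" by auto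
  have "?S \<union> ?T \<subseteq> A"
  proof -
    have "w ` {s m..l} \<subseteq> A" using inA sub by blast
    then show ?thesis using inA neg_in by blast
  qed
  then have "int (card (free m w)) = int (card A) - int (card (?S \<union> ?T))"
    unfolding free_def using finite_A card_mono[of A "?S \<union> ?T"]
    by (simp add: card_Diff_subset of_nat_diff)
  moreover have "int (card ?S) + int (card ?T) = int (card (?S \<union> ?T)) + int (card (?S \<inter> ?T))"
    using card_Un_Int[of ?S ?T] by simp
  ultimately show ?thesis using cS cT cI by linarith
qed

definition count_fixed :: "nat \<Rightarrow> nat \<Rightarrow> int" where
  "count_fixed m c = (\<Sum>z\<in>admissible m. of_bool (e \<in> z ` {c..l}))"

text \<open>The \<open>k\<close>-th factor of the product to be proved, for \<open>k \<ge> 2\<close>. It is also used for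
  \<open>k = l + 1\<close>; hence the integer difference \<open>int l - int k\<close>, which is then negative.\<close>

definition factor :: "nat \<Rightarrow> int" where
  "factor k = int (card A) - (int l - int k) - int (Suc l - s (k - 1))"

text \<open>The number of choices at \<open>m\<close> is governed by the factor with index \<open>m + 1\<close>, not \<open>m\<close>.\<close>

lemma card_free_factor:
  assumes m: "1 \<le> m" "m \<le> l" and w: "w \<in> admissible (Suc m)"
  shows "int (card (free m w)) = factor (Suc m) - 1 + of_bool (e \<in> w ` {s m..l})"
  using card_free[OF assms] m unfolding factor_def by (simp add: of_nat_diff)

lemma card_admissible_step:
  assumes m: "1 \<le> m" "m \<le> l"
  shows "int (card (admissible m)) =
    (factor (Suc m) - 1) * int (card (admissible (Suc m))) + count_fixed (Suc m) (s m)"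
proof -
  have "int (card (admissible m)) = (\<Sum>w\<in>admissible (Suc m). int (card (free m w)))"
    using sum_admissible[OF m, of "\<lambda>_. 1"] by simp
  also have "\<dots> = (\<Sum>w\<in>admissible (Suc m). factor (Suc m) - 1 + of_bool (e \<in> w ` {s m..l}))"
    by (intro sum.cong refl card_free_factor[OF m])
  finally show ?thesis
    by (simp only: count_fixed_def sum.distrib sum_constant mult.commute)
qed

lemma fun_upd_image_tail: "m < c \<Longrightarrow> (w(m := y)) ` {c..l} = w ` {c..l}"
  by (rule image_cong) auto

text \<open>If \<open>e\<close> occurs at a position \<open>\<ge> c \<ge> s m\<close>, then the correction in the number of choices at
  \<open>m\<close> is always present, so that this number is constant.\<close>

lemma count_fixed_step:
  assumes m: "1 \<le> m" "m \<le> l" and c: "s m \<le> c"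
  shows "count_fixed m c = factor (Suc m) * count_fixed (Suc m) c"
proof -
  have mc: "m < c" using s_gt[OF m] c by simp
  have "count_fixed m c =
    (\<Sum>w\<in>admissible (Suc m). int (card (free m w)) * of_bool (e \<in> w ` {c..l}))"
    unfolding count_fixed_def sum_admissible[OF m] fun_upd_image_tail[OF mc] by simp
  also have "\<dots> = (\<Sum>w\<in>admissible (Suc m). factor (Suc m) * of_bool (e \<in> w ` {c..l}))"
  proof (rule sum.cong[OF refl])
    fix w assume w: "w \<in> admissible (Suc m)"
    have "e \<in> w ` {c..l} \<Longrightarrow> e \<in> w ` {s m..l}" using c by auto
    then show "int (card (free m w)) * of_bool (e \<in> w ` {c..l}) =
        factor (Suc m) * of_bool (e \<in> w ` {c..l})"
      using card_free_factor[OF m w] by auto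
  qed
  finally show ?thesis unfolding count_fixed_def by (simp add: sum_distrib_left)
qed

text \<open>Here \<open>e\<close> occurs either at a position \<open>> m\<close>, with a constant number of choices at \<open>m\<close> as
  before, or only at \<open>m\<close> itself. The latter choice is possible for every tuple that does not
  contain \<open>e\<close>, because the opposite of an entry other than \<open>e\<close> is not \<open>e\<close>.\<close>

lemma count_fixed_step_full:
  assumes m: "1 \<le> m" "m \<le> l" and full: "s m = Suc m"
  shows "count_fixed m m = factor (Suc m) * count_fixed (Suc m) (Suc m)
    + (int (card (admissible (Suc m))) - count_fixed (Suc m) (Suc m))"
proof -
  have ins: "{m..l} = insert m {Suc m..l}" using m by auto
  have "(\<Sum>y\<in>free m w. of_bool (e \<in> (w(m := y)) ` {m..l})) =
      factor (Suc m) * of_bool (e \<in> w ` {Suc m..l}) + (1 - of_bool (e \<in> w ` {Suc m..l}))"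
    if w: "w \<in> admissible (Suc m)" for w
  proof -
    have img: "(w(m := y)) ` {m..l} = insert y (w ` {Suc m..l})" for y
      unfolding ins by (auto simp: image_iff)
    show ?thesis
    proof (cases "e \<in> w ` {Suc m..l}")
      case True
      then show ?thesis using card_free_factor[OF m w] full unfolding img by simp
    next
      case False
      have "e \<in> free m w"
      proof -
        have "e \<noteq> neg (w j)" if j: "j \<in> {Suc m..l}" for j
          using admissible_in[OF w j] neg_neg[of "w j"] neg_eq_iff[OF e_in] False j
          by (metis imageI)
        then have "e \<notin> neg ` w ` {Suc m..l}" by blast
        then show ?thesis using False e_in full unfolding free_def by simp
      qed
      moreover have "finite (free m w)" unfolding free_def using finite_A by auto
      ultimately have "(\<Sum>y\<in>free m w. of_bool (e = y)) = (1::int)"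
        by (simp add: of_bool_def)
      then show ?thesis using False unfolding img by simp
    qed
  qed
  then show ?thesis
    unfolding count_fixed_def sum_admissible[OF m]
    by (simp add: sum.distrib sum_subtractf sum_distrib_left)
qed

lemma admissible_empty: "admissible (Suc l) = {\<lambda>_. undefined}"
  unfolding admissible_def by auto

text \<open>The hypothesis on \<open>c\<close> is what the staircase condition says about \<open>c = s (m - 1)\<close>. It leaves
  two cases: \<open>s m \<le> c\<close>, or \<open>c = m\<close> with \<open>s m = m + 1\<close>; in the second case all constraints
  \<open>z\<^sub>i \<noteq> neg z\<^sub>j\<close> with \<open>m \<le> i < j\<close> are present. The induction starts at \<open>m = l\<close> because
  the first formula fails for the empty tuple: with \<open>m = l + 1\<close> it would give \<open>card A + 1\<close>.\<close>

lemma counts: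
  assumes "1 \<le> m" "m \<le> l"
  shows "int (card (admissible m)) = (\<Prod>k\<in>{Suc m..l}. factor k) * (int (card A) - (int l - int m))
    \<and> (\<forall>c. m \<le> c \<and> c \<le> Suc l \<and> s m \<le> max c (Suc m) \<longrightarrow>
        count_fixed m c = int (Suc l - c) * (\<Prod>k\<in>{Suc m..l}. factor k))"
  using assms(2,1)
proof (induction m rule: inc_induct)
  case base
  have "l < s l" "s l \<le> Suc l" using s_gt[of l] s_le[of l] base by blast+
  then have s: "s l = Suc l" by linarith
  have f: "factor (Suc l) = int (card A) + 1" by (simp add: factor_def s)
  have z: "count_fixed (Suc l) (Suc l) = 0" unfolding count_fixed_def by simp
  have X: "int (card (admissible l)) = int (card A)"
    using card_admissible_step[of l] base unfolding s z f admissible_empty by simp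
  have Yl: "count_fixed l l = 1"
    using count_fixed_step_full[of l] base s unfolding z admissible_empty by simp
  have "count_fixed l (Suc l) = 0" unfolding count_fixed_def by simp
  then show ?case using X Yl by (auto simp: le_Suc_eq)
next
  case (step m)
  let ?B = "\<Prod>k\<in>{Suc (Suc m)..l}. factor k"
  \<comment> \<open>With \<open>d = l + 1 - s m\<close>, the step for the first formula is the identity
    \<open>(?D - d - 1) * ?D + d = (?D - d) * (?D - 1)\<close>.\<close>
  let ?D = "int (card A) - (int l - int (Suc m))"
  have m: "1 \<le> m" "m \<le> l" using step by auto
  have X: "int (card (admissible (Suc m))) = ?B * ?D"
    using step by simp
  have Y: "count_fixed (Suc m) c = int (Suc l - c) * ?B"
    if "Suc m \<le> c" "c \<le> Suc l" "s (Suc m) \<le> max c (Suc (Suc m))" for c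
    using step that by simp
  have st: "s (Suc m) \<le> max (s m) (Suc (Suc m))"
    using s_stair[of m "Suc m"] step m by simp
  have Ys: "count_fixed (Suc m) (s m) = int (Suc l - s m) * ?B"
    using Y[of "s m"] st s_gt[OF m] s_le[OF m] by simp
  have f: "factor (Suc m) = ?D - int (Suc l - s m)" unfolding factor_def by simp
  have B: "(\<Prod>k\<in>{Suc m..l}. factor k) = factor (Suc m) * ?B"
    using step by (simp add: prod.atLeast_Suc_atMost)
  have "int (card (admissible m)) = (\<Prod>k\<in>{Suc m..l}. factor k) * (int (card A) - (int l - int m))"
    unfolding card_admissible_step[OF m] X Ys B f by (simp add: algebra_simps)
  moreover have "count_fixed m c = int (Suc l - c) * (\<Prod>k\<in>{Suc m..l}. factor k)"
    if c: "m \<le> c" "c \<le> Suc l" "s m \<le> max c (Suc m)" for c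
  proof (cases "c = m")
    case False
    then have "s m \<le> c" using c by simp
    moreover from this have "count_fixed (Suc m) c = int (Suc l - c) * ?B"
      using Y[of c] c st False by simp
    ultimately show ?thesis using count_fixed_step[OF m] B by simp
  next
    case True
    then have full: "s m = Suc m" using c s_gt[OF m] by simp
    have Yf: "count_fixed (Suc m) (Suc m) = (int l - int m) * ?B"
      using Ys m unfolding full by (simp add: of_nat_diff)
    have f': "factor (Suc m) = ?D - (int l - int m)"
      using f m unfolding full by (simp add: of_nat_diff)
    have "int (Suc l - c) = int l - int m + 1" using True m by simp
    then show ?thesis
      unfolding True count_fixed_step_full[OF m full] Yf X B f' by (simp add: algebra_simps)
  qed
  ultimately show ?case by simp
qed

lemma card_admissible:
  assumes "1 \<le> l"
  shows "int (card (admissible 1)) =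
    (\<Prod>k=1..l. int (card A) - (int l - int k) - (if k = 1 then 0 else int (Suc l - s (k - 1))))"
proof -
  have "int (card (admissible 1)) = (int (card A) - (int l - 1)) * (\<Prod>k\<in>{Suc 1..l}. factor k)"
    using counts[of 1] assms by simp
  also have "(\<Prod>k\<in>{Suc 1..l}. factor k) = (\<Prod>k\<in>{Suc 1..l}. int (card A) - (int l - int k)
      - (if k = 1 then 0 else int (Suc l - s (k - 1))))"
    by (rule prod.cong) (auto simp: factor_def)
  finally show ?thesis using assms by (simp add: prod.atLeast_Suc_atMost)
qed

end

section \<open>The staircase of an ideal\<close>

text \<open>With \<open>b = 0\<close> the relation \<open>root_ge_B l a b\<close> describes the cone generated by the simple
  roots, which is closed under addition.\<close>

lemma root_ge_B_iff_diff: "root_ge_B l a b \<longleftrightarrow> root_ge_B l (a - b) 0"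
  unfolding root_ge_B_def by simp

lemma root_ge_B_zero: "root_ge_B l 0 0"
  unfolding root_ge_B_def by (intro exI[of _ "\<lambda>_. 0"]) (simp add: fun_eq_iff)

lemma sum_fun_apply: "(\<Sum>i\<in>S. f i) x = (\<Sum>i\<in>S. f i x)"
  for f :: "'a \<Rightarrow> 'b \<Rightarrow> 'c::comm_monoid_add"
  by (induction S rule: infinite_finite_induct) auto

lemma root_ge_B_add:
  assumes "root_ge_B l a 0" "root_ge_B l b 0"
  shows "root_ge_B l (a + b) 0"
proof -
  obtain c d where "a = (\<Sum>i=1..l. (\<lambda>k. int (c i) * simple_root_B l i k))"
    and "b = (\<Sum>i=1..l. (\<lambda>k. int (d i) * simple_root_B l i k))"
    using assms unfolding root_ge_B_def by auto
  then have "a + b - 0 = (\<Sum>i=1..l. (\<lambda>k. int (c i + d i) * simple_root_B l i k))"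
    by (simp add: fun_eq_iff sum_fun_apply sum.distrib distrib_right)
  then show ?thesis unfolding root_ge_B_def by (rule exI[where x = "\<lambda>i. c i + d i"])
qed

lemma root_ge_B_simple:
  assumes "1 \<le> i" "i \<le> l"
  shows "root_ge_B l (simple_root_B l i) 0"
proof -
  have "(\<Sum>j=1..l. (\<lambda>k. int (of_bool (j = i)) * simple_root_B l j k)) =
      (\<Sum>j=1..l. if j = i then simple_root_B l j else 0)"
    by (rule sum.cong) (auto simp: fun_eq_iff)
  also have "\<dots> = simple_root_B l i" using assms by simp
  finally show ?thesis unfolding root_ge_B_def by (intro exI[of _ "\<lambda>j. of_bool (j = i)"]) simp
qed

text \<open>The difference telescopes: it is the sum of the simple roots
  \<open>\<epsilon>\<^sub>k - \<epsilon>\<^sub>k\<^sub>+\<^sub>1\<close> with \<open>i \<le> k < j\<close>.\<close>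

lemma root_ge_B_eps_diff:
  assumes "1 \<le> i" "i \<le> j" "j \<le> l"
  shows "root_ge_B l (eps i - eps j) 0"
  using assms(2,1,3)
proof (induction j rule: dec_induct)
  case base
  show ?case using root_ge_B_zero[of l] by (metis diff_self)
next
  case (step j)
  have "root_ge_B l (eps i - eps j + simple_root_B l j) 0"
  proof (rule root_ge_B_add)
    show "root_ge_B l (eps i - eps j) 0" using step.IH step.prems by (meson Suc_leD)
    show "root_ge_B l (simple_root_B l j) 0" using step by (intro root_ge_B_simple) auto
  qed
  moreover have "simple_root_B l j = eps j - eps (Suc j)"
    using step by (simp add: simple_root_B_def)
  ultimately show ?case by (simp only: diff_add_cancel add_diff_eq)
qed

lemma root_ge_B_eps:
  assumes "1 \<le> i" "i \<le> l"
  shows "root_ge_B l (eps i) 0"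
proof -
  have "root_ge_B l (eps i - eps l + simple_root_B l l) 0"
    using assms by (intro root_ge_B_add root_ge_B_simple root_ge_B_eps_diff) auto
  then show ?thesis by (simp add: simple_root_B_def)
qed

lemma ideal_B_mem:
  assumes "ideal_B l I" "a \<in> I" "b \<in> pos_roots_B l" "root_ge_B l (a - b) 0"
  shows "b \<in> I"
  using assms root_ge_B_iff_diff[of l a b] unfolding ideal_B_def by blast

lemma ideal_B_eps:
  assumes "ideal_B l I" "eps 1 \<in> I" "1 \<le> i" "i \<le> l"
  shows "eps i \<in> I"
  by (rule ideal_B_mem[OF assms(1,2)])
    (use assms in \<open>auto simp: pos_roots_B_def intro: root_ge_B_eps_diff\<close>)

lemma ideal_B_minus:
  assumes "ideal_B l I" "eps 1 \<in> I" "1 \<le> i" "i < j" "j \<le> l"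
  shows "eps i - eps j \<in> I"
proof (rule ideal_B_mem[OF assms(1,2)])
  show "eps i - eps j \<in> pos_roots_B l" using assms unfolding pos_roots_B_def by blast
  have "root_ge_B l ((eps 1 - eps i) + eps j) 0"
    using assms by (intro root_ge_B_add root_ge_B_eps_diff root_ge_B_eps) auto
  then show "root_ge_B l (eps 1 - (eps i - eps j)) 0" by (simp add: algebra_simps)
qed

lemma ideal_B_plus:
  assumes "ideal_B l I" "eps i + eps j \<in> I" "1 \<le> i" "i \<le> i'" "j \<le> j'" "i' < j'" "j' \<le> l"
    and "i < j"
  shows "eps i' + eps j' \<in> I"
proof (rule ideal_B_mem[OF assms(1,2)])
  show "eps i' + eps j' \<in> pos_roots_B l" using assms unfolding pos_roots_B_def by force
  have "root_ge_B l ((eps i - eps i') + (eps j - eps j')) 0"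
    using assms by (intro root_ge_B_add root_ge_B_eps_diff) auto
  then show "root_ge_B l (eps i + eps j - (eps i' + eps j')) 0" by (simp add: algebra_simps)
qed

text \<open>The threshold of the row \<open>k\<close>. The position \<open>l + 1\<close> always qualifies, so the value is
  \<open>l + 1\<close> if \<open>I\<close> has no root \<open>\<epsilon>\<^sub>k + \<epsilon>\<^sub>j\<close>.\<close>

definition plus_start :: "nat \<Rightarrow> (nat \<Rightarrow> int) set \<Rightarrow> nat \<Rightarrow> nat" where
  "plus_start l I k = (LEAST j. k < j \<and> (j \<le> l \<longrightarrow> eps k + eps j \<in> I))"

lemma plus_start:
  assumes "k \<le> l"
  shows "k < plus_start l I k" "plus_start l I k \<le> Suc l"
    and "plus_start l I k \<le> l \<Longrightarrow> eps k + eps (plus_start l I k) \<in> I"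
proof -
  let ?P = "\<lambda>j. k < j \<and> (j \<le> l \<longrightarrow> eps k + eps j \<in> I)"
  have Suc: "?P (Suc l)" using assms by simp
  have "?P (plus_start l I k)" unfolding plus_start_def using Suc by (rule LeastI)
  then show "k < plus_start l I k"
    "plus_start l I k \<le> l \<Longrightarrow> eps k + eps (plus_start l I k) \<in> I" by blast+
  show "plus_start l I k \<le> Suc l" unfolding plus_start_def using Suc by (rule Least_le)
qed

lemma plus_start_le:
  "k < j \<Longrightarrow> (j \<le> l \<Longrightarrow> eps k + eps j \<in> I) \<Longrightarrow> plus_start l I k \<le> j"
  unfolding plus_start_def by (rule Least_le) simp

lemma plus_mem_iff:
  assumes "ideal_B l I" "1 \<le> k" "k < j" "j \<le> l"
  shows "eps k + eps j \<in> I \<longleftrightarrow> plus_start l I k \<le> j"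
proof
  assume j: "plus_start l I k \<le> j"
  have "k \<le> l" using assms by simp
  show "eps k + eps j \<in> I"
    by (rule ideal_B_plus[OF assms(1) plus_start(3)[OF \<open>k \<le> l\<close>]])
      (use j assms plus_start(1)[OF \<open>k \<le> l\<close>] in simp_all)
next
  assume "eps k + eps j \<in> I"
  then show "plus_start l I k \<le> j" using assms by (intro plus_start_le)
qed

lemma plus_start_staircase:
  assumes "ideal_B l I" "1 \<le> i" "i < k" "k \<le> l"
  shows "plus_start l I k \<le> max (plus_start l I i) (Suc k)"
proof (rule plus_start_le)
  assume le: "max (plus_start l I i) (Suc k) \<le> l"
  have i: "i \<le> l" using assms by simp
  show "eps k + eps (max (plus_start l I i) (Suc k)) \<in> I"
    by (rule ideal_B_plus[OF assms(1) plus_start(3)[OF i]])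
      (use le assms plus_start(1)[OF i] in simp_all)
qed simp

lemma p_num_eq:
  assumes "ideal_B l I" "eps 1 \<in> I" "1 \<le> k" "k \<le> l"
  shows "int (p_num l I k) =
    int l - int k + (if k = 1 then 0 else int (Suc l - plus_start l I (k - 1)))"
proof -
  have "{j. k < j \<and> j \<le> l \<and> eps k - eps j \<in> I} = {Suc k..l}"
    using ideal_B_minus[OF assms(1,2)] assms by auto
  then have "d_minus l I k = l - k" unfolding d_minus_def by simp
  moreover have "d_plus l I (k - 1) = (if k = 1 then 0 else Suc l - plus_start l I (k - 1))"
  proof -
    have "{j. k - 1 < j \<and> j \<le> l \<and> eps (k - 1) + eps j \<in> I} = {plus_start l I (k - 1)..l}"
      if "k \<noteq> 1"
    proof -
      have "1 \<le> k - 1" "k - 1 \<le> l" using assms(3,4) that by auto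
      then show ?thesis
        using plus_mem_iff[OF assms(1), of "k - 1"] plus_start(1)[of "k - 1" l I]
        by (auto dest: less_le_trans)
    qed
    then show ?thesis unfolding d_plus_def using assms by auto
  qed
  ultimately show ?thesis unfolding p_num_def using assms by auto
qed

section \<open>The quasi-polynomial as a count of admissible tuples\<close>

lemma sum_mult_eps: "a \<in> {1..l} \<Longrightarrow> (\<Sum>i=1..l. z i * eps a i) = z a"
  by (simp add: eps_def if_distrib[of "\<lambda>x. _ * x"] cong: if_cong)

lemma sum_mult_plus:
  "a \<in> {1..l} \<Longrightarrow> b \<in> {1..l} \<Longrightarrow> (\<Sum>i=1..l. z i * (eps a + eps b) i) = z a + z b"
  using sum_mult_eps[of a l z] sum_mult_eps[of b l z]
  by (simp add: distrib_left sum.distrib)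

lemma sum_mult_minus:
  "a \<in> {1..l} \<Longrightarrow> b \<in> {1..l} \<Longrightarrow> (\<Sum>i=1..l. z i * (eps a - eps b) i) = z a - z b"
  using sum_mult_eps[of a l z] sum_mult_eps[of b l z]
  by (simp add: right_diff_distrib sum_subtractf)

lemma diff_mod_eq_0_iff:
  fixes x y r :: int
  assumes "x \<in> {0..<r}" "y \<in> {0..<r}"
  shows "(x - y) mod r = 0 \<longleftrightarrow> x = y"
  using assms by (auto simp: mod_eq_dvd_iff[symmetric] mod_eq_0_iff_dvd)

lemma add_mod_eq_0_iff:
  fixes x y r :: int
  assumes "x \<in> {0..<r}"
  shows "(x + y) mod r = 0 \<longleftrightarrow> x = (- y) mod r"
proof -
  have "(x + y) mod r = 0 \<longleftrightarrow> x mod r = (- y) mod r"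
    using mod_eq_dvd_iff[of x r "- y"] by (simp add: mod_eq_0_iff_dvd)
  then show ?thesis using assms by simp
qed


lemma pos_roots_D_not_eps:
  assumes "1 \<le> i" "i < j"
  shows "eps i + eps j \<noteq> eps k" "eps i - eps j \<noteq> eps k"
proof -
  show "eps i + eps j \<noteq> eps k"
  proof
    assume "eps i + eps j = eps k"
    then have "(eps i + eps j) i = eps k i" "(eps i + eps j) j = eps k j" by simp_all
    then show False using assms by (auto simp: eps_def split: if_splits)
  qed
  show "eps i - eps j \<noteq> eps k"
  proof
    assume "eps i - eps j = eps k"
    then have "(eps i - eps j) j = eps k j" by simp
    then show False using assms by (auto simp: eps_def split: if_splits)
  qed
qed

text \<open>The sets \<open>D\<close> between \<open>I \<inter> \<Phi>\<^sup>+(D\<^sub>l)\<close> and \<open>I\<close> differ only in their short roots. Treating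
  them uniformly covers \<open>I\<close> and \<open>J\<close> at once.\<close>

lemma ball_roots_up_to_short_iff:
  assumes ideal: "ideal_B l I" and one: "eps 1 \<in> I"
    and D: "D \<subseteq> I" "I \<inter> pos_roots_D l \<subseteq> D"
  shows "(\<forall>\<beta>\<in>D. Q \<beta>) \<longleftrightarrow>
    (\<forall>i\<in>{1..l}. eps i \<in> D \<longrightarrow> Q (eps i)) \<and>
    (\<forall>i\<in>{1..l}. \<forall>j\<in>{i<..l}. Q (eps i - eps j) \<and>
      (plus_start l I i \<le> j \<longrightarrow> Q (eps i + eps j)))"
    (is "_ \<longleftrightarrow> ?short \<and> ?long")
proof (intro iffI conjI ballI)
  fix i j assume Q: "\<forall>\<beta>\<in>D. Q \<beta>" and ij: "i \<in> {1..l}" "j \<in> {i<..l}"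
  have "eps i - eps j \<in> I" using ideal_B_minus[OF ideal one, of i j] ij by simp
  moreover have "eps i - eps j \<in> pos_roots_D l" using ij unfolding pos_roots_D_def by auto
  ultimately show "Q (eps i - eps j)" using D Q by blast
  have "eps i + eps j \<in> pos_roots_D l" using ij unfolding pos_roots_D_def by auto
  moreover have "plus_start l I i \<le> j \<Longrightarrow> eps i + eps j \<in> I"
    using plus_mem_iff[OF ideal, of i j] ij by simp
  ultimately show "plus_start l I i \<le> j \<longrightarrow> Q (eps i + eps j)" using D Q by blast
next
  fix \<beta> assume Q: "?short \<and> ?long" and \<beta>: "\<beta> \<in> D"
  have "\<beta> \<in> pos_roots_B l" using \<beta> D ideal unfolding ideal_B_def by blast
  then consider
    (short) i where "i \<in> {1..l}" "\<beta> = eps i"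
    | (plus) i j where "i \<in> {1..l}" "j \<in> {i<..l}" "\<beta> = eps i + eps j"
    | (minus) i j where "i \<in> {1..l}" "j \<in> {i<..l}" "\<beta> = eps i - eps j"
    unfolding pos_roots_B_def by fastforce
  then show "Q \<beta>"
  proof cases
    case short
    then show ?thesis using Q \<beta> by blast
  next
    case plus
    then have "plus_start l I i \<le> j"
      using plus_mem_iff[OF ideal, of i j] \<beta> D by auto
    then show ?thesis using plus Q by blast
  next
    case minus
    then show ?thesis using Q by blast
  qed
qed blast

text \<open>The set \<open>A\<close> consists of the residues that the short roots in \<open>D\<close> leave possible (hypothesis
  \<open>short\<close>), and the count depends on it only through its cardinality.\<close>

lemma chi_quasi_eq_prod:
  assumes ideal: "ideal_B l I" and one: "eps 1 \<in> I" and l: "1 \<le> l"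
    and D: "D \<subseteq> I" "I \<inter> pos_roots_D l \<subseteq> D"
    and A: "finite A" "A \<subseteq> {0..<int r}" "\<And>a. a \<in> A \<Longrightarrow> (- a) mod int r \<in> A"
    and e: "e \<in> A" "\<And>a. a \<in> A \<Longrightarrow> (- a) mod int r = a \<longleftrightarrow> a = e"
    and short: "\<And>z. z \<in> {1..l} \<rightarrow>\<^sub>E {0..<int r} \<Longrightarrow>
           (\<forall>i\<in>{1..l}. eps i \<in> D \<longrightarrow> z i \<noteq> 0) \<longleftrightarrow> z \<in> {1..l} \<rightarrow>\<^sub>E A"
  shows "int (chi_quasi l D r) = (\<Prod>i=1..l. int (card A) - int (p_num l I i))"
proof -
  let ?s = "plus_start l I" and ?neg = "\<lambda>x. (- x) mod int r"
  interpret staircase_count A ?neg e l ?s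
  proof
    show "?neg (?neg a) = a" if "a \<in> A" for a
      using that A(2) by (auto simp: mod_minus_eq)
  qed (use A e plus_start plus_start_staircase[OF ideal] in auto)
  have mem: "z \<in> admissible 1 \<longleftrightarrow> (\<forall>\<beta>\<in>D. (\<Sum>i=1..l. z i * \<beta> i) mod int r \<noteq> 0)"
    if z: "z \<in> {1..l} \<rightarrow>\<^sub>E {0..<int r}" for z
  proof -
    have zr: "z i \<in> {0..<int r}" if "i \<in> {1..l}" for i using z that by auto
    have "(\<forall>\<beta>\<in>D. (\<Sum>i=1..l. z i * \<beta> i) mod int r \<noteq> 0) \<longleftrightarrow>
        (\<forall>i\<in>{1..l}. eps i \<in> D \<longrightarrow> z i \<noteq> 0) \<and>
        (\<forall>i\<in>{1..l}. \<forall>j\<in>{i<..l}. z i \<noteq> z j \<and> (?s i \<le> j \<longrightarrow> z i \<noteq> ?neg (z j)))"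
      unfolding ball_roots_up_to_short_iff[OF ideal one D]
    proof (intro arg_cong2[where f = "(\<and>)"] ball_cong refl)
      fix i assume i: "i \<in> {1..l}"
      show "(eps i \<in> D \<longrightarrow> (\<Sum>k=1..l. z k * eps i k) mod int r \<noteq> 0) \<longleftrightarrow>
          (eps i \<in> D \<longrightarrow> z i \<noteq> 0)"
        using zr[OF i] unfolding sum_mult_eps[OF i] by simp
      fix j assume "j \<in> {i<..l}"
      then have j: "j \<in> {1..l}" by simp
      show "(\<Sum>k=1..l. z k * (eps i - eps j) k) mod int r \<noteq> 0 \<longleftrightarrow> z i \<noteq> z j"
        unfolding sum_mult_minus[OF i j] diff_mod_eq_0_iff[OF zr[OF i] zr[OF j]] by (rule refl)
      show "(?s i \<le> j \<longrightarrow> (\<Sum>k=1..l. z k * (eps i + eps j) k) mod int r \<noteq> 0) \<longleftrightarrow>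
          (?s i \<le> j \<longrightarrow> z i \<noteq> ?neg (z j))"
        unfolding sum_mult_plus[OF i j] add_mod_eq_0_iff[OF zr[OF i]] by (rule refl)
    qed
    also have "\<dots> \<longleftrightarrow> z \<in> admissible 1"
      unfolding short[OF z] admissible_def by force
    finally show ?thesis by (rule sym)
  qed
  have sub: "admissible 1 \<subseteq> {1..l} \<rightarrow>\<^sub>E {0..<int r}"
    unfolding admissible_def using A(2) by (auto simp: PiE_def Pi_def)
  have "admissible 1 =
      {z \<in> {1..l} \<rightarrow>\<^sub>E {0..<int r}. \<forall>\<beta>\<in>D. (\<Sum>i=1..l. z i * \<beta> i) mod int r \<noteq> 0}"
    (is "_ = ?R")
  proof -
    have "z \<in> admissible 1 \<longleftrightarrow> z \<in> ?R" for z
    proof (cases "z \<in> {1..l} \<rightarrow>\<^sub>E {0..<int r}")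
      case True
      then show ?thesis using mem[OF True] by (simp only: mem_Collect_eq simp_thms)
    next
      case False
      then have "z \<notin> admissible 1" using sub by (meson subsetD)
      with False show ?thesis by (simp only: mem_Collect_eq simp_thms)
    qed
    then show ?thesis by (rule set_eqI)
  qed
  then have "int (chi_quasi l D r) = int (card (admissible 1))"
    unfolding chi_quasi_def by simp
  also have "\<dots> = (\<Prod>k=1..l. int (card A) - (int l - int k)
      - (if k = 1 then 0 else int (Suc l - ?s (k - 1))))"
    by (rule card_admissible[OF l])
  also have "\<dots> = (\<Prod>k=1..l. int (card A) - int (p_num l I k))"
    by (rule prod.cong) (simp_all add: p_num_eq[OF ideal one])
  finally show ?thesis .
qed

theorem theorem3p2:
  fixes l q :: nat and I J :: "(nat \<Rightarrow> int) set"
  assumes "3 \<le> l"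
    and "ideal_B l I"
    and "eps 1 \<in> I"
    and "J = I - {eps i | i. 1 \<le> i \<and> i \<le> l \<and> eps i \<in> I}"
    and "0 < q" and "even q"
  shows "chi_quasi l I q = chi_quasi l J (q - 1) \<and>
         int (chi_quasi l J (q - 1)) = (\<Prod>i=1..l. int q - int (p_num l I i) - 1)"
proof -
  have l: "1 \<le> l" using assms(1) by simp
  obtain h where q: "q = 2 * h" and h: "0 < h" using assms(5,6) by auto
  have "int (chi_quasi l I q) = (\<Prod>i=1..l. int (card {1..<int q}) - int (p_num l I i))"
  proof (rule chi_quasi_eq_prod[OF assms(2,3) l, where e = "int h"])
    fix a :: int assume a: "a \<in> {1..<int q}"
    have "(- a) mod int q = int q - a"
      using a by (simp add: zmod_zminus1_eq_if)
    then show "(- a) mod int q \<in> {1..<int q}" "(- a) mod int q = a \<longleftrightarrow> a = int h"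
      using a q by auto
  next
    fix z assume z: "z \<in> {1..l} \<rightarrow>\<^sub>E {0..<int q}"
    have pos: "z i \<noteq> 0 \<longleftrightarrow> z i \<in> {1..<int q}" if "i \<in> {1..l}" for i
      using PiE_mem[OF z that] by auto
    have eps: "eps i \<in> I" if "i \<in> {1..l}" for i
      using ideal_B_eps[OF assms(2,3)] that by simp
    have "z \<in> extensional {1..l}" using z by (simp add: PiE_iff)
    then show "(\<forall>i\<in>{1..l}. eps i \<in> I \<longrightarrow> z i \<noteq> 0) \<longleftrightarrow> z \<in> {1..l} \<rightarrow>\<^sub>E {1..<int q}"
      unfolding PiE_iff using pos eps by blast
  next
    show "int h \<in> {1..<int q}" using q h by simp
    show "{1..<int q} \<subseteq> {0..<int q}" by auto
  next
    show "finite {1..<int q}" by simp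
    show "I \<subseteq> I" "I \<inter> pos_roots_D l \<subseteq> I" by blast+
  qed
  moreover have "int (chi_quasi l J (q - 1)) =
      (\<Prod>i=1..l. int (card {0..<int (q - 1)}) - int (p_num l I i))"
  proof (rule chi_quasi_eq_prod[OF assms(2,3) l, where e = 0])
    have "\<beta> \<noteq> eps k" if "\<beta> \<in> pos_roots_D l" for \<beta> k
      using that unfolding pos_roots_D_def by (elim UnE CollectE exE) (simp_all add: pos_roots_D_not_eps)
    then show "I \<inter> pos_roots_D l \<subseteq> J"
      unfolding assms(4) by blast
  next
    fix a :: int assume a: "a \<in> {0..<int (q - 1)}"
    show "(- a) mod int (q - 1) \<in> {0..<int (q - 1)}" using a by auto
    show "(- a) mod int (q - 1) = a \<longleftrightarrow> a = 0"
    proof (cases "a = 0")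
      case False
      then have "(- a) mod int (q - 1) = int (q - 1) - a"
        using a by (simp add: zmod_zminus1_eq_if)
      moreover have "int (q - 1) = 2 * int h - 1" using q h by simp
      moreover have "2 * int h - 1 - a \<noteq> a" by presburger
      ultimately show ?thesis using False by simp
    qed simp
  next
    fix z
    have "eps i \<notin> J" if "i \<in> {1..l}" for i using that unfolding assms(4) by auto
    then show "(\<forall>i\<in>{1..l}. eps i \<in> J \<longrightarrow> z i \<noteq> 0) \<longleftrightarrow> z \<in> {1..l} \<rightarrow>\<^sub>E {0..<int (q - 1)}"
      if "z \<in> {1..l} \<rightarrow>\<^sub>E {0..<int (q - 1)}" using that by auto
  next
    show "J \<subseteq> I" using assms(4) by blast
    show "(0::int) \<in> {0..<int (q - 1)}" using q h by simp
    show "finite {0..<int (q - 1)}" by simp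
    show "{0..<int (q - 1)} \<subseteq> {0..<int (q - 1)}" by (rule order_refl)
  qed
  moreover have "int (card {1..<int q}) = int q - 1" "int (card {0..<int (q - 1)}) = int q - 1"
    using assms(5) by simp_all
  ultimately show ?thesis by (simp add: algebra_simps)
qed

end
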